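(* Let $p$ be a prime and let $t \geq 2$ be an integer. If $p \neq 3$, then $$s'_{pt}\left((\mathbb{Z}/p\mathbb{Z})^2\right) = (t+2)p - 2.$$ If $p = 3$, then $$s'_{3t}\left((\mathbb{Z}/3\mathbb{Z})^2\right) = 3(t+1).$$
   Context: A sequence in an abelian group $G$ is a finite list of elements of $G$ (repetitions allowed); a subsequence is obtained by selecting any subset of the positions (not necessarily consecutive). A sequence is zero-sum if its terms sum to $0$ in $G$. For a positive integer $L$, the modified Erdős–Ginzburg–Ziv constant $s'_L(G)$ is the smallest integer $\ell$ such that every zero-sum sequence in $G$ of length at least $\ell$ contains a zero-sum subsequence of length $L$. *)

theory Defs
  imports "HOL-Algebra.Elementary_Groups" "HOL-Computational_Algebra.Primes" "HOL-Library.Extended_Nat"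
begin

text \<open>Groups are written multiplicatively in HOL-Algebra, so ``zero-sum'' means that
  the product of the terms is the neutral element.\<close>

definition zero_sum :: "('a, 'b) monoid_scheme \<Rightarrow> 'a list \<Rightarrow> bool" where
  "zero_sum G xs \<longleftrightarrow>
     set xs \<subseteq> carrier G \<and> foldr (\<lambda>x y. x \<otimes>\<^bsub>G\<^esub> y) xs \<one>\<^bsub>G\<^esub> = \<one>\<^bsub>G\<^esub>"

definition has_zero_sum_subseq :: "('a, 'b) monoid_scheme \<Rightarrow> nat \<Rightarrow> 'a list \<Rightarrow> bool" where
  "has_zero_sum_subseq G L xs \<longleftrightarrow>
     (\<exists>I. I \<subseteq> {..<length xs} \<and> length (nths xs I) = L \<and> zero_sum G (nths xs I))"

text \<open>The infimum is taken in \<^typ>\<open>enat\<close>: it is the smallest admissible length if there is one,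
  and \<open>\<infinity>\<close> if there is none.\<close>

definition modified_EGZ :: "nat \<Rightarrow> ('a, 'b) monoid_scheme \<Rightarrow> enat" where
  "modified_EGZ L G =
     Inf {enat l | l. \<forall>xs. zero_sum G xs \<and> length xs \<ge> l \<longrightarrow> has_zero_sum_subseq G L xs}"

end

theory Submission imports Defs "HOL-Number_Theory.Cong" begin

text \<open>
  Upper bound. An alternating sum over all subsets of a set \<open>J\<close> of a product of fewer than \<open>card J\<close>
  affine functions vanishes. Since \<open>(x - 1) \<cdots> (x - (p - 1))\<close> is, up to a unit, the indicator of
  \<open>p dvd x\<close> modulo \<open>p\<close>, the zero-sum subsequences of \<open>J\<close> of length \<open>k * p\<close>, counted with sign
  \<open>(-1) ^ k\<close>, add up to \<open>0\<close> modulo \<open>p\<close> whenever \<open>card J > 3 * (p - 1)\<close>. Applying this to a sequence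
  of length \<open>4 * p - 2\<close> and, after double counting, to its subsequences of length \<open>3 * p - 2\<close>, one
  gets contradictory congruences if there is no zero-sum subsequence of length \<open>p\<close> (for odd \<open>p\<close>),
  or none of length \<open>2 * p\<close>. Splitting off blocks of length \<open>p\<close> then reaches every \<open>t\<close>. For \<open>p = 3\<close>
  and length \<open>3 * (t + 1)\<close> one takes the complement of a zero-sum block of length \<open>3\<close>.

  Lower bound. The sequence \<open>0\<close> (\<open>p * t - 1\<close> times), \<open>e\<^sub>1\<close> and \<open>e\<^sub>2\<close> (\<open>p - 1\<close> times each) has no
  zero-sum subsequence of length \<open>p * t\<close>, and translation preserves this. Its length is
  congruent to \<open>-3\<close>, so for \<open>p \<noteq> 3\<close> some translate has sum zero; for \<open>p = 3\<close> one copy of \<open>e\<^sub>2\<close> has to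
  be dropped first.
\<close>

section \<open>Alternating sums over subsets modulo a prime\<close>

text \<open>Induction on the number of factors. Expanding one factor leaves a constant multiple of a
  shorter sum and, for each \<open>i\<close> in \<open>J\<close>, a sum over the sets
  \<open>I\<close> containing \<open>i\<close>. Removing \<open>i\<close> from these sets flips the
  sign and shifts the constants \<open>c\<close> by \<open>w k i\<close>, so the induction
  hypothesis is needed for arbitrary \<open>c\<close> and for \<open>J - {i}\<close>.\<close>

lemma alternating_sum_prod_affine:
  fixes c :: "'k \<Rightarrow> 'a::comm_ring_1" and w :: "'k \<Rightarrow> 'i \<Rightarrow> 'a"
  assumes "finite K" "finite J" "card K < card J"
  shows "(\<Sum>I\<in>Pow J. (-1) ^ card I * (\<Prod>k\<in>K. c k + (\<Sum>i\<in>I. w k i))) = 0"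
  using assms
proof (induction K arbitrary: J c rule: finite_induct)
  case empty
  have "(\<Sum>I\<in>Pow J. (-1) ^ card I) = (\<Prod>i\<in>J. (-1) + (1 :: 'a))"
    using empty.prems(1) by (subst prod_add) simp_all
  also have "\<dots> = 0" using empty.prems by (auto simp: power_0_left)
  finally show ?case by simp
next
  case (insert k K)
  let ?G = "\<lambda>c I. \<Prod>k\<in>K. c k + (\<Sum>i\<in>I. w k i)"
  have card: "card K < card J" "\<And>i. i \<in> J \<Longrightarrow> card K < card (J - {i})"
    using insert by auto
  have shift: "(\<Sum>I | I \<subseteq> J \<and> i \<in> I. (-1) ^ card I * ?G c I) = 0" if "i \<in> J" for i
  proof -
    let ?c = "\<lambda>k. c k + w k i"
    have eq: "{I. I \<subseteq> J \<and> i \<in> I} = Set.insert i ` Pow (J - {i})"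
    proof (intro equalityI subsetI)
      fix I assume "I \<in> {I. I \<subseteq> J \<and> i \<in> I}"
      then have "I = Set.insert i (I - {i})" "I - {i} \<in> Pow (J - {i})" by auto
      then show "I \<in> Set.insert i ` Pow (J - {i})" by blast
    qed (use that in auto)
    have inj: "inj_on (Set.insert i) (Pow (J - {i}))"
      by (rule inj_onI) (auto dest: insert_ident[THEN iffD1, rotated 2])
    have "(\<Sum>I | I \<subseteq> J \<and> i \<in> I. (-1) ^ card I * ?G c I)
        = (\<Sum>I\<in>Pow (J - {i}). - ((-1) ^ card I * ?G ?c I))"
      unfolding eq sum.reindex[OF inj] o_def
    proof (rule sum.cong[OF refl])
      fix I assume I: "I \<in> Pow (J - {i})"
      then have "finite I" "i \<notin> I" using insert.prems(1) by (auto intro: finite_subset)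
      then show "(-1) ^ card (Set.insert i I) * ?G c (Set.insert i I) = - ((-1) ^ card I * ?G ?c I)"
        by (simp add: add.assoc)
    qed
    also have "\<dots> = 0"
      using insert.IH[of "J - {i}" ?c] insert.prems card(2)[OF that] by (simp add: sum_negf)
    finally show ?thesis .
  qed
  have "(\<Sum>I\<in>Pow J. (-1) ^ card I * (\<Prod>k\<in>Set.insert k K. c k + (\<Sum>i\<in>I. w k i)))
     = (\<Sum>I\<in>Pow J. c k * ((-1) ^ card I * ?G c I) + (\<Sum>i\<in>I. w k i * ((-1) ^ card I * ?G c I)))"
    using insert.hyps by (intro sum.cong refl) (simp add: algebra_simps sum_distrib_left sum_distrib_right)
  also have "\<dots> = c k * (\<Sum>I\<in>Pow J. (-1) ^ card I * ?G c I)
      + (\<Sum>I\<in>Pow J. \<Sum>i | i \<in> J \<and> i \<in> I. w k i * ((-1) ^ card I * ?G c I))"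
    unfolding sum.distrib sum_distrib_left
    by (intro arg_cong2[where f = "(+)"] sum.cong refl) auto
  also have "(\<Sum>I\<in>Pow J. \<Sum>i | i \<in> J \<and> i \<in> I. w k i * ((-1) ^ card I * ?G c I))
      = (\<Sum>i\<in>J. w k i * (\<Sum>I | I \<subseteq> J \<and> i \<in> I. (-1) ^ card I * ?G c I))"
    using sum.swap_restrict[of "Pow J" J "\<lambda>I i. w k i * ((-1) ^ card I * ?G c I)" "\<lambda>I i. i \<in> I"]
      insert.prems(1) by (simp add: sum_distrib_left)
  also have "\<dots> = 0" using shift by simp
  finally show ?case using insert.IH[OF insert.prems(1) card(1)] by simp
qed

text \<open>If \<open>p\<close> does not divide \<open>x\<close>, the factor with
  \<open>r = x mod p\<close> is divisible by \<open>p\<close>; otherwise each factor reduces to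
  \<open>- int r\<close>.\<close>

lemma prod_diff_cong:
  fixes p :: nat and x :: int
  assumes "prime p"
  shows "[(\<Prod>r = 1..<p. - int r + x) = (if int p dvd x then \<Prod>r = 1..<p. - int r else 0)] (mod int p)"
proof (cases "int p dvd x")
  case True
  then have "[(\<Prod>r = 1..<p. - int r + x) = (\<Prod>r = 1..<p. - int r)] (mod int p)"
    by (intro cong_prod) (simp add: cong_iff_dvd_diff)
  with True show ?thesis by simp
next
  case False
  have p: "p > 0" using assms prime_gt_0_nat by auto
  define r where "r = nat (x mod int p)"
  have "int r = x mod int p" using p by (simp add: r_def)
  moreover from this have "r \<noteq> 0" "r < p" using False p
    by (auto simp: dvd_eq_mod_eq_0) (metis of_nat_0_less_iff of_nat_less_iff pos_mod_bound)
  ultimately have "r \<in> {1..<p}" "int p dvd - int r + x" by auto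
  then have "int p dvd (\<Prod>r = 1..<p. - int r + x)"
    by (meson dvd_prodI dvd_trans finite_atLeastLessThan)
  with False show ?thesis by (simp add: cong_0_iff)
qed

text \<open>Modulo \<open>p\<close>, the product of \<open>- int r + (sum of f d over I)\<close>
  over all \<open>d\<close> in \<open>D\<close> and \<open>r\<close> in \<open>{1..<p}\<close> is
  the unit \<open>u ^ card D\<close> times the indicator of the divisibility conditions. It has
  \<open>card D * (p - 1)\<close> affine factors, fewer than \<open>card J\<close>, so its
  alternating sum vanishes and the unit cancels.\<close>

lemma alternating_count_zero_sum:
  fixes p :: nat and f :: "'d \<Rightarrow> 'i \<Rightarrow> int"
  assumes p: "prime p" and fin: "finite D" "finite J" and card: "card D * (p - 1) < card J"
  shows "[(\<Sum>I | I \<subseteq> J \<and> (\<forall>d\<in>D. int p dvd (\<Sum>i\<in>I. f d i)). (-1) ^ card I) = (0::int)] (mod int p)"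
proof -
  define u where "u = (\<Prod>r = 1..<p. - int r)"
  let ?P = "\<lambda>I. \<forall>d\<in>D. int p dvd (\<Sum>i\<in>I. f d i)"
  have "coprime u (int p)"
    unfolding u_def
  proof (rule prod_coprime_left)
    fix r assume "r \<in> {1..<p}"
    then have "\<not> p dvd r" by (auto dest: dvd_imp_le)
    then show "coprime (- int r) (int p)"
      using p by (simp add: coprime_commute prime_imp_coprime)
  qed
  then have cop: "coprime (u ^ card D) (int p)" by simp
  have prod_u: "[(\<Prod>d\<in>D. \<Prod>r = 1..<p. - int r + (\<Sum>i\<in>I. f d i)) = (if ?P I then u ^ card D else 0)] (mod int p)"
    for I
  proof -
    have "[(\<Prod>d\<in>D. \<Prod>r = 1..<p. - int r + (\<Sum>i\<in>I. f d i))
       = (\<Prod>d\<in>D. if int p dvd (\<Sum>i\<in>I. f d i) then u else 0)] (mod int p)"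
      unfolding u_def by (intro cong_prod prod_diff_cong p)
    also have "(\<Prod>d\<in>D. if int p dvd (\<Sum>i\<in>I. f d i) then u else 0) = (if ?P I then u ^ card D else 0)"
      using fin(1) by (auto intro!: prod_zero)
    finally show ?thesis .
  qed
  have "(\<Sum>I\<in>Pow J. (-1) ^ card I * (\<Prod>(d, r)\<in>D \<times> {1..<p}. - int r + (\<Sum>i\<in>I. f d i))) = 0"
    using alternating_sum_prod_affine[of "D \<times> {1..<p}" J "\<lambda>(d, r). - int r" "\<lambda>(d, r). f d"] fin card
    by (simp add: case_prod_unfold)
  then have "0 = (\<Sum>I\<in>Pow J. (-1) ^ card I * (\<Prod>d\<in>D. \<Prod>r = 1..<p. - int r + (\<Sum>i\<in>I. f d i)))"
    by (simp add: prod.cartesian_product)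
  also have "[\<dots> = (\<Sum>I\<in>Pow J. (-1) ^ card I * (if ?P I then u ^ card D else 0))] (mod int p)"
    by (intro cong_sum cong_mult cong_refl prod_u)
  also have "(\<Sum>I\<in>Pow J. (-1) ^ card I * (if ?P I then u ^ card D else 0))
      = (\<Sum>I\<in>Pow J. if ?P I then u ^ card D * (-1) ^ card I else 0)"
    by (intro sum.cong refl) auto
  also have "\<dots> = u ^ card D * (\<Sum>I\<in>{I \<in> Pow J. ?P I}. (-1) ^ card I)"
    unfolding sum_distrib_left using fin by (intro sum.inter_filter[symmetric]) simp
  finally have "[u ^ card D * 0 = u ^ card D * (\<Sum>I | I \<subseteq> J \<and> ?P I. (-1) ^ card I)] (mod int p)"
    by (simp add: Pow_def)
  then show ?thesis
    using cong_mult_lcancel[OF cop] cong_sym by blast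
qed

section \<open>Binomial coefficients modulo p and counting supersets\<close>

text \<open>A case of Lucas' theorem. In Vandermonde's identity for splitting off \<open>p\<close>
  elements, all terms except the two extreme ones contain a factor \<open>p choose k\<close>
  divisible by \<open>p\<close>, so each step of the induction adds 1.\<close>

lemma choose_prime_cong:
  fixes p m r :: nat
  assumes p: "prime p" and r: "r < p"
  shows "[int ((m * p + r) choose p) = int m] (mod int p)"
proof (induction m)
  case 0
  then show ?case using r by (simp add: binomial_eq_0)
next
  case (Suc m)
  have p0: "p > 0" using p prime_gt_0_nat by auto
  have "(Suc m * p + r) choose p = (\<Sum>k\<le>p. (p choose k) * ((m * p + r) choose (p - k)))"
    by (simp add: vandermonde add.assoc)
  also have "\<dots> = (\<Sum>k\<in>{0, p} \<union> {0<..<p}. (p choose k) * ((m * p + r) choose (p - k)))"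
    by (rule sum.cong) auto
  also have "\<dots> = ((m * p + r) choose p) + 1 + (\<Sum>k\<in>{0<..<p}. (p choose k) * ((m * p + r) choose (p - k)))"
    using p0 by (subst sum.union_disjoint) auto
  finally have "int ((Suc m * p + r) choose p) = int ((m * p + r) choose p) + 1
      + int (\<Sum>k\<in>{0<..<p}. (p choose k) * ((m * p + r) choose (p - k)))" by simp
  moreover have "p dvd (\<Sum>k\<in>{0<..<p}. (p choose k) * ((m * p + r) choose (p - k)))"
    using p by (intro dvd_sum dvd_mult2 dvd_choose_prime) auto
  then have "[int (\<Sum>k\<in>{0<..<p}. (p choose k) * ((m * p + r) choose (p - k))) = 0] (mod int p)"
    by (simp only: cong_0_iff of_nat_dvd_iff)
  ultimately show ?case
    using cong_add[OF cong_add[OF Suc.IH cong_refl[of 1]]] by (fastforce simp: add.commute)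
qed

lemma card_supersets:
  assumes "finite X" "I \<subseteq> X" "card I \<le> j"
  shows "card {J. I \<subseteq> J \<and> J \<subseteq> X \<and> card J = j} = (card X - card I) choose (j - card I)"
proof -
  have fI: "finite I" using assms finite_subset by blast
  have "bij_betw (\<lambda>J. J \<union> I) {J. J \<subseteq> X - I \<and> card J = j - card I} {J. I \<subseteq> J \<and> J \<subseteq> X \<and> card J = j}"
  proof (rule bij_betw_byWitness[where f' = "\<lambda>J. J - I"])
    show "(\<lambda>J. J \<union> I) ` {J. J \<subseteq> X - I \<and> card J = j - card I} \<subseteq> {J. I \<subseteq> J \<and> J \<subseteq> X \<and> card J = j}"
    proof safe
      fix J assume J: "J \<subseteq> X - I" "card J = j - card I"
      then have "finite J" "J \<inter> I = {}" using assms(1) by (auto intro: finite_subset)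
      then show "card (J \<union> I) = j" using J fI assms(3) by (simp add: card_Un_disjoint)
    qed (use assms in auto)
    show "(\<lambda>J. J - I) ` {J. I \<subseteq> J \<and> J \<subseteq> X \<and> card J = j} \<subseteq> {J. J \<subseteq> X - I \<and> card J = j - card I}"
      using fI by (auto simp: card_Diff_subset)
  qed auto
  then have "card {J. I \<subseteq> J \<and> J \<subseteq> X \<and> card J = j} = card {J. J \<subseteq> X - I \<and> card J = j - card I}"
    by (simp add: bij_betw_same_card)
  also have "\<dots> = (card X - card I) choose (j - card I)"
    using assms fI by (simp add: n_subsets card_Diff_subset)
  finally show ?thesis .
qed

section \<open>Zero-sum index sets and their numbers\<close>

text \<open>A sequence in the square of the integers mod \<open>p\<close> is represented by integer
  coordinates \<open>a\<close> and \<open>b\<close> on an index set, so that subsequences become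
  plain subsets and complements and unions are available.\<close>

definition dvd_sums :: "nat \<Rightarrow> ('i \<Rightarrow> int) \<Rightarrow> ('i \<Rightarrow> int) \<Rightarrow> 'i set \<Rightarrow> bool" where
  "dvd_sums p a b I \<longleftrightarrow> int p dvd sum a I \<and> int p dvd sum b I"

lemma dvd_sums_Diff:
  assumes "finite X" "I \<subseteq> X" "dvd_sums p a b I" "dvd_sums p a b X"
  shows "dvd_sums p a b (X - I)"
  using assms by (simp add: dvd_sums_def sum_diff)

lemma dvd_sums_Un:
  assumes "finite I" "finite J" "I \<inter> J = {}" "dvd_sums p a b I" "dvd_sums p a b J"
  shows "dvd_sums p a b (I \<union> J)"
  using assms by (simp add: dvd_sums_def sum.union_disjoint)

definition num_dvd_sums :: "nat \<Rightarrow> ('i \<Rightarrow> int) \<Rightarrow> ('i \<Rightarrow> int) \<Rightarrow> nat \<Rightarrow> 'i set \<Rightarrow> nat" where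
  "num_dvd_sums p a b k X = card {I. I \<subseteq> X \<and> card I = k \<and> dvd_sums p a b I}"

lemma num_dvd_sums_0_iff:
  assumes "finite X"
  shows "num_dvd_sums p a b k X = 0 \<longleftrightarrow> (\<forall>I\<subseteq>X. card I = k \<longrightarrow> \<not> dvd_sums p a b I)"
  using assms by (auto simp: num_dvd_sums_def)

lemma num_dvd_sums_0_subset:
  assumes "finite X" "J \<subseteq> X" "num_dvd_sums p a b k X = 0"
  shows "num_dvd_sums p a b k J = 0"
proof -
  have "finite J" using assms(1,2) by (rule finite_subset[rotated])
  then show ?thesis using assms by (auto simp: num_dvd_sums_0_iff)
qed

lemma num_dvd_sums_0 [simp]:
  assumes "finite X"
  shows "num_dvd_sums p a b 0 X = 1"
proof -
  have "{I. I \<subseteq> X \<and> card I = 0 \<and> dvd_sums p a b I} = {{}}"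
    using assms by (auto simp: dvd_sums_def dest: finite_subset)
  then show ?thesis by (simp add: num_dvd_sums_def)
qed

text \<open>The alternating count is applied to three conditions, the constant function 1 encoding
  \<open>p dvd card I\<close>. The upper bound on \<open>card J\<close> leaves only the sizes
  \<open>k * p\<close> with \<open>k\<close> at most \<open>m\<close>.\<close>

lemma alternating_num_dvd_sums:
  assumes p: "prime p" and fin: "finite J" and card: "3 * (p - 1) < card J" "card J < Suc m * p"
  shows "[(\<Sum>k\<le>m. (-1) ^ k * int (num_dvd_sums p a b (k * p) J)) = 0] (mod int p)"
proof -
  define S where "S = {I. I \<subseteq> J \<and> p dvd card I \<and> dvd_sums p a b I}"
  define f :: "nat \<Rightarrow> 'a \<Rightarrow> int" where "f d = (if d = 0 then \<lambda>_. 1 else if d = 1 then a else b)" for d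
  have p0: "p > 0" using p prime_gt_0_nat by auto
  have [simp]: "finite S" using fin by (simp add: S_def)
  have S_eq: "S = {I. I \<subseteq> J \<and> (\<forall>d\<in>{0,1,2}. int p dvd (\<Sum>i\<in>I. f d i))}"
    by (auto simp: S_def f_def dvd_sums_def)
  have sub: "(\<lambda>I. card I div p) ` S \<subseteq> {..m}"
  proof (rule image_subsetI)
    fix I assume "I \<in> S"
    then have "card I \<le> card J"
      by (intro card_mono fin) (simp add: S_def)
    then have "card I < Suc m * p" using card(2) by (rule le_less_trans)
    then show "card I div p \<in> {..m}"
      by (metis atMost_iff less_Suc_eq_le less_mult_imp_div_less)
  qed
  \<comment> \<open>For odd \<open>p\<close> this is an equality; for \<open>p = 2\<close> it holds
    because 1 and -1 agree modulo 2. It turns \<open>(-1) ^ (k * p)\<close> into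
    \<open>(-1) ^ k\<close>.\<close>
  have sign: "[(-1) ^ p = (-1 :: int)] (mod int p)"
  proof (cases "p = 2")
    case False
    then have "odd p" using p prime_odd_nat prime_ge_2_nat[OF p] by force
    then show ?thesis by simp
  qed (simp add: cong_def)
  have "(\<Sum>k\<le>m. (-1) ^ (k * p) * int (num_dvd_sums p a b (k * p) J))
      = (\<Sum>k\<le>m. \<Sum>I | I \<in> S \<and> card I div p = k. (-1) ^ card I)"
  proof (rule sum.cong[OF refl])
    fix k
    have "{I. I \<in> S \<and> card I div p = k} = {I. I \<subseteq> J \<and> card I = k * p \<and> dvd_sums p a b I}"
      using p0 by (auto simp: S_def)
    then show "(-1) ^ (k * p) * int (num_dvd_sums p a b (k * p) J)
        = (\<Sum>I | I \<in> S \<and> card I div p = k. (-1) ^ card I)"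
      by (simp add: num_dvd_sums_def)
  qed
  also have "\<dots> = (\<Sum>I\<in>S. (-1) ^ card I)"
    using sub by (simp add: sum.group)
  also have "[\<dots> = 0] (mod int p)"
    unfolding S_eq using alternating_count_zero_sum[OF p _ fin, of "{0,1,2::nat}" f] card(1) by simp
  finally have *: "[(\<Sum>k\<le>m. (-1) ^ (k * p) * int (num_dvd_sums p a b (k * p) J)) = 0] (mod int p)" .
  have "[(\<Sum>k\<le>m. (-1) ^ k * int (num_dvd_sums p a b (k * p) J))
      = (\<Sum>k\<le>m. (-1) ^ (k * p) * int (num_dvd_sums p a b (k * p) J))] (mod int p)"
    using cong_pow[OF cong_sym[OF sign]]
    by (intro cong_sum cong_mult cong_refl) (simp add: mult.commute[of _ p] power_mult)
  then show ?thesis using * cong_trans by blast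
qed

text \<open>Double counting of pairs \<open>I\<close>, \<open>J\<close> with \<open>I\<close> inside
  \<open>J\<close>: each \<open>I\<close> of size \<open>k\<close> lies in the same number of sets
  \<open>J\<close>.\<close>

lemma sum_num_dvd_sums:
  assumes "finite X" "k \<le> j"
  shows "(\<Sum>J | J \<subseteq> X \<and> card J = j. num_dvd_sums p a b k J)
      = num_dvd_sums p a b k X * ((card X - k) choose (j - k))"
proof -
  let ?A = "{J. J \<subseteq> X \<and> card J = j}" and ?B = "{I. I \<subseteq> X \<and> card I = k \<and> dvd_sums p a b I}"
  have "(\<Sum>J\<in>?A. num_dvd_sums p a b k J) = (\<Sum>J\<in>?A. \<Sum>I | I \<in> ?B \<and> I \<subseteq> J. 1)"
    unfolding num_dvd_sums_def card_eq_sum by (intro sum.cong refl) auto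
  also have "\<dots> = (\<Sum>I\<in>?B. \<Sum>J | J \<in> ?A \<and> I \<subseteq> J. 1)"
    using assms(1) by (intro sum.swap_restrict) auto
  also have "\<dots> = (\<Sum>I\<in>?B. (card X - k) choose (j - k))"
  proof (rule sum.cong[OF refl])
    fix I assume "I \<in> ?B"
    then have "card {J. I \<subseteq> J \<and> J \<subseteq> X \<and> card J = j} = (card X - k) choose (j - k)"
      using card_supersets[OF assms(1), of I j] assms(2) by auto
    moreover have "{J. I \<subseteq> J \<and> J \<subseteq> X \<and> card J = j} = {J. J \<in> ?A \<and> I \<subseteq> J}" by auto
    ultimately show "(\<Sum>J | J \<in> ?A \<and> I \<subseteq> J. 1) = (card X - k) choose (j - k)" by simp
  qed
  finally show ?thesis by (simp add: num_dvd_sums_def)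
qed

text \<open>The factor is the binomial coefficient \<open>(4 * p - 2 - k * p) choose p\<close> modulo \<open>p\<close>.\<close>

lemma sum_num_dvd_sums_cong:
  assumes p: "prime p" and X: "finite X" "card X = 4 * p - 2" and k: "k \<le> 2"
  shows "[(\<Sum>J | J \<subseteq> X \<and> card J = 3 * p - 2. int (num_dvd_sums p a b (k * p) J))
      = (3 - int k) * int (num_dvd_sums p a b (k * p) X)] (mod int p)"
proof -
  have p2: "p \<ge> 2" using p prime_ge_2_nat by auto
  have "k * p \<le> 2 * p" using k by simp
  then have le: "k * p \<le> 3 * p - 2" using p2 by linarith
  \<comment> \<open>This is the shape required by \<open>choose_prime_cong\<close>, with multiplier
    \<open>3 - k\<close> and remainder \<open>p - 2\<close>, after passing to the complementary
    binomial coefficient.\<close>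
  have eq: "card X - k * p = (3 - k) * p + (p - 2)" "(3 * p - 2) - k * p = ((3 - k) * p + (p - 2)) - p"
    using k p2 X(2) by (auto simp: algebra_simps diff_mult_distrib)
  have "1 * p \<le> (3 - k) * p" using k by (intro mult_le_mono1) simp
  then have "p \<le> (3 - k) * p + (p - 2)" by linarith
  then have "((3 - k) * p + (p - 2)) choose (((3 - k) * p + (p - 2)) - p) = ((3 - k) * p + (p - 2)) choose p"
    by (rule binomial_symmetric[symmetric])
  moreover have "[int (((3 - k) * p + (p - 2)) choose p) = int (3 - k)] (mod int p)"
    using p p2 by (intro choose_prime_cong) auto
  ultimately have "[int ((card X - k * p) choose ((3 * p - 2) - k * p)) = int (3 - k)] (mod int p)"
    by (simp only: eq)
  then have "[int (num_dvd_sums p a b (k * p) X * ((card X - k * p) choose ((3 * p - 2) - k * p)))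
      = int (num_dvd_sums p a b (k * p) X) * int (3 - k)] (mod int p)"
    unfolding of_nat_mult by (intro cong_mult cong_refl)
  then show ?thesis
    using k unfolding sum_num_dvd_sums[OF X(1) le, symmetric] by (simp add: of_nat_diff mult.commute)
qed

text \<open>The case \<open>k = 0\<close> of the preceding congruence, where only the empty set is
  counted.\<close>

lemma card_subsets_cong:
  assumes "prime p" "finite X" "card X = 4 * p - 2"
  shows "[int (card {J. J \<subseteq> X \<and> card J = 3 * p - 2}) = 3] (mod int p)"
proof -
  let ?z = "\<lambda>_. 0 :: int"
  have "(\<Sum>J | J \<subseteq> X \<and> card J = 3 * p - 2. int (num_dvd_sums p ?z ?z (0 * p) J))
      = (\<Sum>J | J \<subseteq> X \<and> card J = 3 * p - 2. 1)"
    using assms(2) by (intro sum.cong refl) (auto dest: finite_subset)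
  then show ?thesis
    using sum_num_dvd_sums_cong[OF assms, of 0 ?z ?z] assms(2) by simp
qed

section \<open>Existence of zero-sum blocks\<close>

text \<open>Otherwise the empty set alone would contribute to the alternating count on
  \<open>3 * p - 2\<close> elements, giving 1 = 0 modulo \<open>p\<close>.\<close>

lemma dvd_sums_p_or_2p:
  assumes p: "prime p" and X: "finite X" "3 * p - 2 \<le> card X"
  shows "\<exists>I\<subseteq>X. (card I = p \<or> card I = 2 * p) \<and> dvd_sums p a b I"
proof (rule ccontr)
  assume no: "\<not> ?thesis"
  have p2: "p \<ge> 2" using p prime_ge_2_nat by auto
  obtain J where J: "J \<subseteq> X" "card J = 3 * p - 2" "finite J"
    using obtain_subset_with_card_n[OF X(2)] by auto
  have "num_dvd_sums p a b p J = 0" "num_dvd_sums p a b (2 * p) J = 0"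
    using no J by (auto simp: num_dvd_sums_0_iff)
  then have "[1 = (0 :: int)] (mod int p)"
    using alternating_num_dvd_sums[OF p J(3), of 2 a b] J p2 by (simp add: eval_nat_numeral)
  then show False using p2 by (auto simp: cong_def)
qed

text \<open>Taking complements in \<open>X\<close> exchanges the sizes \<open>p\<close> and
  \<open>2 * p\<close>, so having one gives both.\<close>

lemma dvd_sums_3p_split:
  assumes p: "prime p" and X: "finite X" "card X = 3 * p" "dvd_sums p a b X"
  shows "\<exists>I\<subseteq>X. card I = p \<and> dvd_sums p a b I" "\<exists>I\<subseteq>X. card I = 2 * p \<and> dvd_sums p a b I"
proof -
  obtain I where I: "I \<subseteq> X" "card I = p \<or> card I = 2 * p" "dvd_sums p a b I"
    using dvd_sums_p_or_2p[OF p X(1)] X(2) by (metis diff_le_self)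
  then have "dvd_sums p a b (X - I)" "card (X - I) = 3 * p - card I"
    using X by (auto simp: dvd_sums_Diff card_Diff_subset finite_subset)
  then show "\<exists>I\<subseteq>X. card I = p \<and> dvd_sums p a b I" "\<exists>I\<subseteq>X. card I = 2 * p \<and> dvd_sums p a b I"
    using I by (auto intro: exI[of _ I] exI[of _ "X - I"])
qed

text \<open>This removes the term \<open>k = 3\<close> from the alternating count on
  \<open>4 * p - 2\<close> elements.\<close>

lemma num_dvd_sums_3p:
  assumes p: "prime p" and X: "finite X"
    and 0: "num_dvd_sums p a b p X = 0 \<or> num_dvd_sums p a b (2 * p) X = 0"
  shows "num_dvd_sums p a b (3 * p) X = 0"
proof -
  have "\<not> dvd_sums p a b I" if I: "I \<subseteq> X" "card I = 3 * p" for I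
  proof
    assume "dvd_sums p a b I"
    note split = dvd_sums_3p_split[OF p finite_subset[OF I(1) X] I(2) this]
    from 0 have "num_dvd_sums p a b p I = 0 \<or> num_dvd_sums p a b (2 * p) I = 0"
      by (elim disj_forward) (erule num_dvd_sums_0_subset[OF X I(1)])+
    then show False using split by (auto simp: num_dvd_sums_0_iff[OF finite_subset[OF I(1) X]])
  qed
  then show ?thesis using X by (simp add: num_dvd_sums_0_iff)
qed

text \<open>Suppose there is no such \<open>I\<close>. The alternating count gives
  \<open>?N p J = 1\<close> modulo \<open>p\<close> for every \<open>J\<close> in \<open>?A\<close>,
  and summing over \<open>?A\<close> yields \<open>3 = 2 * ?N p X\<close>. Applied to
  \<open>X\<close> itself it gives \<open>?N p X = 1\<close>, hence 3 = 2 modulo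
  \<open>p\<close>.\<close>

lemma dvd_sums_2p:
  assumes p: "prime p" and X: "finite X" "card X = 4 * p - 2"
  shows "\<exists>I\<subseteq>X. card I = 2 * p \<and> dvd_sums p a b I"
proof (rule ccontr)
  assume no: "\<not> ?thesis"
  have p2: "p \<ge> 2" using p prime_ge_2_nat by auto
  let ?N = "num_dvd_sums p a b" and ?A = "{J. J \<subseteq> X \<and> card J = 3 * p - 2}"
  have zero: "?N (2 * p) X = 0"
    using no by (simp add: num_dvd_sums_0_iff[OF X(1)])
  note zero = zero num_dvd_sums_3p[OF p X(1) disjI2[OF zero]]
  have "[1 = int (?N p J)] (mod int p)" if "J \<in> ?A" for J
  proof -
    have J: "finite J" "card J = 3 * p - 2" using that X by (auto dest: finite_subset)
    have "?N (2 * p) J = 0" by (rule num_dvd_sums_0_subset[OF X(1) _ zero(1)]) (use that in simp)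
    then show ?thesis
      using alternating_num_dvd_sums[OF p J(1), of 2 a b] J p2
      by (simp add: eval_nat_numeral cong_iff_dvd_diff)
  qed
  then have sum: "[(\<Sum>J\<in>?A. 1) = (\<Sum>J\<in>?A. int (?N p J))] (mod int p)"
    by (rule cong_sum)
  have "[3 = (\<Sum>J\<in>?A. 1)] (mod int p)"
    using cong_sym[OF card_subsets_cong[OF p X]] by simp
  also note sum
  also have "[(\<Sum>J\<in>?A. int (?N p J)) = 2 * int (?N p X)] (mod int p)"
    using sum_num_dvd_sums_cong[OF p X, of 1 a b] by simp
  finally have three: "[3 = 2 * int (?N p X)] (mod int p)" .
  have "[1 = int (?N p X)] (mod int p)"
    using alternating_num_dvd_sums[OF p X(1), of 3 a b] X p2 zero
    by (simp add: eval_nat_numeral cong_iff_dvd_diff)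
  then have "[2 * 1 = 2 * int (?N p X)] (mod int p)" by (intro cong_mult cong_refl)
  from cong_trans[OF three cong_sym[OF this]] have "[3 = (2 :: int)] (mod int p)" by simp
  then show False using p2 by (auto simp: cong_iff_dvd_diff)
qed

text \<open>The counting argument for odd \<open>p\<close> ends in \<open>p dvd 2\<close>, so \<open>p = 2\<close> needs the pigeonhole principle.\<close>

lemma dvd_sums_p:
  assumes p: "prime p" and X: "finite X" "card X = 4 * p - 2"
  shows "\<exists>I\<subseteq>X. card I = p \<and> dvd_sums p a b I"
proof (cases "p = 2")
  case True
  \<comment> \<open>Here \<open>X\<close> has six elements, but there are only four pairs of
    parities.\<close>
  have "\<not> inj_on (\<lambda>i. (a i mod 2, b i mod 2)) X"
  proof
    assume inj: "inj_on (\<lambda>i. (a i mod 2, b i mod 2)) X"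
    have "card X = card ((\<lambda>i. (a i mod 2, b i mod 2)) ` X)" using inj by (simp add: card_image)
    also have "\<dots> \<le> card ({0, 1 :: int} \<times> {0, 1 :: int})" by (rule card_mono) auto
    finally show False using X True by (simp add: card_cartesian_product)
  qed
  then obtain i j where ij: "i \<in> X" "j \<in> X" "i \<noteq> j" "a i mod 2 = a j mod 2" "b i mod 2 = b j mod 2"
    by (auto simp: inj_on_def)
  then have "even (a i + a j)" "even (b i + b j)"
    by (metis even_add even_iff_mod_2_eq_zero)+
  then show ?thesis
    using True ij(1-3) by (intro exI[of _ "{i, j}"]) (simp add: dvd_sums_def)
next
  case False
  have p2: "p > 2" using prime_ge_2_nat[OF p] False by simp
  show ?thesis
  proof (rule ccontr)
    assume no: "\<not> ?thesis"
    let ?N = "num_dvd_sums p a b" and ?A = "{J. J \<subseteq> X \<and> card J = 3 * p - 2}"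
    have zero: "?N p X = 0"
      using no by (simp add: num_dvd_sums_0_iff[OF X(1)])
    note zero = zero num_dvd_sums_3p[OF p X(1) disjI1[OF zero]]
    have "[1 + int (?N (2 * p) J) = 0] (mod int p)" if "J \<in> ?A" for J
    proof -
      have J: "finite J" "card J = 3 * p - 2" using that X by (auto dest: finite_subset)
      have "?N p J = 0" by (rule num_dvd_sums_0_subset[OF X(1) _ zero(1)]) (use that in simp)
      then show ?thesis
        using alternating_num_dvd_sums[OF p J(1), of 2 a b] J p2
        by (simp add: eval_nat_numeral)
    qed
    then have "[(\<Sum>J\<in>?A. 1 + int (?N (2 * p) J)) = (\<Sum>J\<in>?A. 0)] (mod int p)"
      by (rule cong_sum)
    then have sum: "[int (card ?A) + (\<Sum>J\<in>?A. int (?N (2 * p) J)) = 0] (mod int p)"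
      by (simp add: sum.distrib)
    have "[(\<Sum>J\<in>?A. int (?N (2 * p) J)) = int (?N (2 * p) X)] (mod int p)"
      using sum_num_dvd_sums_cong[OF p X, of 2 a b] by simp
    from cong_trans[OF cong_sym[OF cong_add[OF card_subsets_cong[OF p X] this]] sum]
    have "[3 + int (?N (2 * p) X) = 0] (mod int p)" .
    moreover have "[1 + int (?N (2 * p) X) = 0] (mod int p)"
      using alternating_num_dvd_sums[OF p X(1), of 3 a b] X p2 zero
      by (simp add: eval_nat_numeral)
    ultimately have "int p dvd (3 + int (?N (2 * p) X)) - (1 + int (?N (2 * p) X))"
      unfolding cong_0_iff by (rule dvd_diff)
    then have "int p dvd 2" by simp
    then show False using p2 zdvd_imp_le by force
  qed
qed

text \<open>Each induction step removes a block of size \<open>p\<close> found among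
  \<open>4 * p - 2\<close> elements, which lowers the size bound by exactly
  \<open>p\<close>.\<close>

lemma dvd_sums_tp:
  assumes p: "prime p" and t: "t \<ge> 2" and X: "finite X" "(t + 2) * p - 2 \<le> card X"
  shows "\<exists>I\<subseteq>X. card I = p * t \<and> dvd_sums p a b I"
  using t X
proof (induction t arbitrary: X rule: dec_induct)
  case base
  obtain Y where Y: "Y \<subseteq> X" "card Y = 4 * p - 2" "finite Y"
    using obtain_subset_with_card_n[of "4 * p - 2" X] base by auto
  then show ?case using dvd_sums_2p[OF p Y(3,2), of a b] by (auto simp: mult.commute)
next
  case (step t)
  have "4 * p \<le> (Suc t + 2) * p" using step.hyps by (intro mult_le_mono1) simp
  then have "4 * p - 2 \<le> card X" using step.prems(2) by linarith
  then obtain Y where Y: "Y \<subseteq> X" "card Y = 4 * p - 2" "finite Y"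
    using obtain_subset_with_card_n by metis
  obtain I where I: "I \<subseteq> Y" "card I = p" "dvd_sums p a b I"
    using dvd_sums_p[OF p Y(3,2)] by blast
  have fI: "finite I" using I Y finite_subset by blast
  have "card (X - I) = card X - p" using I Y fI by (simp add: card_Diff_subset)
  then have "(t + 2) * p - 2 \<le> card (X - I)" using step.prems(2) by simp
  then obtain K where K: "K \<subseteq> X - I" "card K = p * t" "dvd_sums p a b K"
    using step.IH[of "X - I"] step.prems(1) by auto
  have fK: "finite K" using K step.prems(1) finite_subset by blast
  have "card (I \<union> K) = p * Suc t" using I K fI fK by (subst card_Un_disjoint) auto
  moreover have "dvd_sums p a b (I \<union> K)" using I K fI fK by (intro dvd_sums_Un) auto
  ultimately show ?case using I(1) Y(1) K(1) by (intro exI[of _ "I \<union> K"]) auto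
qed

text \<open>The size is one below the bound of \<open>dvd_sums_tp\<close> for \<open>p = 3\<close>,
  so the divisibility of the sums over all of \<open>X\<close> is used to pass to
  complements.\<close>

lemma dvd_sums_3t:
  assumes t: "t \<ge> 2" and X: "finite X" "card X = 3 * (t + 1)" "dvd_sums 3 a b X"
  shows "\<exists>I\<subseteq>X. card I = 3 * t \<and> dvd_sums 3 a b I"
proof -
  have p: "prime (3 :: nat)" by simp
  have "\<exists>I\<subseteq>X. card I = 3 \<and> dvd_sums 3 a b I"
  \<comment> \<open>For \<open>t = 2\<close> the set has 9 elements, one too few for
    \<open>dvd_sums_p\<close>, but exactly \<open>3 * p\<close>, so it splits.\<close>
  proof (cases "t = 2")
    case True
    then show ?thesis using dvd_sums_3p_split(1)[OF p X(1) _ X(3)] X(2) by simp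
  next
    case False
    then have "4 * 3 - 2 \<le> card X" using t X(2) by simp
    then obtain Y where Y: "Y \<subseteq> X" "card Y = 4 * 3 - 2" "finite Y"
      using obtain_subset_with_card_n by metis
    then show ?thesis using dvd_sums_p[OF p Y(3,2), of a b] by blast
  qed
  then obtain I where I: "I \<subseteq> X" "card I = 3" "dvd_sums 3 a b I" by blast
  then have "dvd_sums 3 a b (X - I)" "card (X - I) = 3 * t"
    using X by (auto simp: dvd_sums_Diff card_Diff_subset finite_subset)
  then show ?thesis by blast
qed

section \<open>Translated indicator functions\<close>

lemma sum_indicator_cong:
  fixes a :: "'i \<Rightarrow> int"
  assumes "finite I" "\<And>i. i \<in> I \<Longrightarrow> [a i = u + of_bool (i \<in> K)] (mod m)"
  shows "[sum a I = int (card I) * u + int (card (I \<inter> K))] (mod m)"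
proof -
  have "[sum a I = (\<Sum>i\<in>I. u + of_bool (i \<in> K))] (mod m)"
    using assms(2) by (rule cong_sum)
  also have "(\<Sum>i\<in>I. u + of_bool (i \<in> K)) = int (card I) * u + int (card (I \<inter> K))"
    using assms(1) by (simp add: sum.distrib of_bool_def sum.If_cases Collect_mem_eq)
  finally show ?thesis .
qed

text \<open>Since \<open>p\<close> divides \<open>card I\<close>, the translation by
  \<open>u\<close> disappears from the sum. What is left is \<open>card (I \<inter> K)\<close>, a
  multiple of \<open>p\<close> smaller than \<open>p\<close>.\<close>

lemma card_Int_eq_0_of_dvd:
  assumes "finite I" "finite K" "card K < p" "card I = p * t"
    and "\<And>i. i \<in> I \<Longrightarrow> [a i = u + of_bool (i \<in> K)] (mod int p)" "int p dvd sum a I"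
  shows "I \<inter> K = {}"
proof -
  have "[sum a I = int (card I) * u + int (card (I \<inter> K))] (mod int p)"
    using assms(1,5) by (rule sum_indicator_cong)
  then have "int p dvd int (card I) * u + int (card (I \<inter> K))"
    using assms(6) cong_dvd_iff by blast
  then have "p dvd card (I \<inter> K)"
    using assms(4) by (simp add: dvd_add_right_iff mult.assoc)
  moreover have "card (I \<inter> K) < p"
    using card_mono[of K "I \<inter> K"] assms(2,3) by simp
  ultimately have "card (I \<inter> K) = 0"
    by (meson nat_dvd_not_less not_gr_zero)
  then show ?thesis using assms(1) by simp
qed

section \<open>From lists over the group to index sets\<close>

lemma zero_sum_integer_mod_group_prod_iff:
  assumes "p > 0"
  shows "zero_sum (integer_mod_group p \<times>\<times> integer_mod_group p) xs \<longleftrightarrow>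
    set xs \<subseteq> {0..<int p} \<times> {0..<int p} \<and>
    int p dvd sum_list (map fst xs) \<and> int p dvd sum_list (map snd xs)"
proof -
  let ?G = "integer_mod_group p \<times>\<times> integer_mod_group p"
  have "foldr (\<lambda>x y. x \<otimes>\<^bsub>?G\<^esub> y) xs \<one>\<^bsub>?G\<^esub>
      = (sum_list (map fst xs) mod int p, sum_list (map snd xs) mod int p)"
    by (induction xs) (auto simp: DirProd_def mod_add_right_eq)
  then show ?thesis
    using assms by (auto simp: zero_sum_def DirProd_def carrier_integer_mod_group dvd_eq_mod_eq_0)
qed

lemma sum_list_map_nths:
  assumes "I \<subseteq> {..<length xs}"
  shows "sum_list (map f (nths xs I)) = (\<Sum>i\<in>I. f (xs ! i))"
proof -
  have "zip xs [0..<length xs] = map (\<lambda>i. (xs ! i, i)) [0..<length xs]"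
    by (rule nth_equalityI) auto
  then have "map f (nths xs I) = map (\<lambda>i. f (xs ! i)) (filter (\<lambda>i. i \<in> I) [0..<length xs])"
    by (simp add: nths_def filter_map o_def)
  also have "sum_list \<dots> = (\<Sum>i\<in>set (filter (\<lambda>i. i \<in> I) [0..<length xs]). f (xs ! i))"
    by (simp add: sum_list_distinct_conv_sum_set)
  also have "set (filter (\<lambda>i. i \<in> I) [0..<length xs]) = I"
    using assms by auto
  finally show ?thesis .
qed

lemma zero_sum_nths_iff:
  assumes "p > 0" "set xs \<subseteq> {0..<int p} \<times> {0..<int p}" "I \<subseteq> {..<length xs}"
  shows "zero_sum (integer_mod_group p \<times>\<times> integer_mod_group p) (nths xs I) \<longleftrightarrow>
    dvd_sums p (\<lambda>i. fst (xs ! i)) (\<lambda>i. snd (xs ! i)) I"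
  using assms(2) set_nths_subset[of xs I]
  by (auto simp: zero_sum_integer_mod_group_prod_iff[OF assms(1)] sum_list_map_nths[OF assms(3)]
      dvd_sums_def)

lemma zero_sum_iff_dvd_sums:
  assumes "p > 0" "set xs \<subseteq> {0..<int p} \<times> {0..<int p}"
  shows "zero_sum (integer_mod_group p \<times>\<times> integer_mod_group p) xs \<longleftrightarrow>
    dvd_sums p (\<lambda>i. fst (xs ! i)) (\<lambda>i. snd (xs ! i)) {..<length xs}"
  using zero_sum_nths_iff[OF assms order_refl] by simp

lemma has_zero_sum_subseq_iff:
  assumes "p > 0" "set xs \<subseteq> {0..<int p} \<times> {0..<int p}"
  shows "has_zero_sum_subseq (integer_mod_group p \<times>\<times> integer_mod_group p) L xs \<longleftrightarrow>
    (\<exists>I\<subseteq>{..<length xs}. card I = L \<and> dvd_sums p (\<lambda>i. fst (xs ! i)) (\<lambda>i. snd (xs ! i)) I)"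
proof -
  have "length (nths xs I) = card I" if "I \<subseteq> {..<length xs}" for I
    using that unfolding length_nths by (intro arg_cong[of _ _ card]) auto
  then show ?thesis
    using zero_sum_nths_iff[OF assms] unfolding has_zero_sum_subseq_def by (intro ex_cong1) auto
qed

section \<open>Extremal sequences and the value of the constant\<close>

text \<open>The witness consists of \<open>n\<close> zeros, \<open>k\<close> copies of the first and
  \<open>l\<close> copies of the second unit vector, all translated by \<open>(u, v)\<close>; the
  last two hypotheses make its total sum zero. A zero-sum subsequence of length \<open>p * t\<close>
  must avoid both unit vectors, but there are fewer than \<open>p * t\<close> zeros.\<close>

lemma zero_sum_without_subseq:
  fixes u v :: int
  assumes "p > 0" "n < p * t" "k < p" "l < p"
    and u: "int p dvd int (n + k + l) * u + int k" and v: "int p dvd int (n + k + l) * v + int l"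
  shows "\<exists>xs. zero_sum (integer_mod_group p \<times>\<times> integer_mod_group p) xs \<and> length xs = n + k + l \<and>
    \<not> has_zero_sum_subseq (integer_mod_group p \<times>\<times> integer_mod_group p) (p * t) xs"
proof -
  define N where "N = n + k + l"
  define K L where "K = {n..<n + k}" and "L = {n + k..<N}"
  define xs where "xs = map (\<lambda>i. ((u + of_bool (i \<in> K)) mod int p, (v + of_bool (i \<in> L)) mod int p)) [0..<N]"
  have len: "length xs = N" by (simp add: xs_def)
  have set: "set xs \<subseteq> {0..<int p} \<times> {0..<int p}" using assms(1) by (auto simp: xs_def)
  have fst: "[fst (xs ! i) = u + of_bool (i \<in> K)] (mod int p)"
    and snd: "[snd (xs ! i) = v + of_bool (i \<in> L)] (mod int p)" if "i < N" for i
    using that by (simp_all add: xs_def cong_def)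
  have KL: "finite K" "finite L" "card K = k" "card L = l" "{..<N} \<inter> K = K" "{..<N} \<inter> L = L"
    by (auto simp: K_def L_def N_def)
  have "[(\<Sum>i<N. fst (xs ! i)) = int N * u + int k] (mod int p)"
    using sum_indicator_cong[of "{..<N}" "\<lambda>i. fst (xs ! i)" u K "int p"] fst KL by simp
  moreover have "[(\<Sum>i<N. snd (xs ! i)) = int N * v + int l] (mod int p)"
    using sum_indicator_cong[of "{..<N}" "\<lambda>i. snd (xs ! i)" v L "int p"] snd KL by simp
  ultimately have "dvd_sums p (\<lambda>i. fst (xs ! i)) (\<lambda>i. snd (xs ! i)) {..<length xs}"
    using u v unfolding dvd_sums_def len N_def by (auto simp: cong_dvd_iff)
  then have "zero_sum (integer_mod_group p \<times>\<times> integer_mod_group p) xs"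
    using zero_sum_iff_dvd_sums[OF assms(1) set] by simp
  moreover have "\<not> dvd_sums p (\<lambda>i. fst (xs ! i)) (\<lambda>i. snd (xs ! i)) I"
    if I: "I \<subseteq> {..<N}" "card I = p * t" for I
  proof
    assume dvd: "dvd_sums p (\<lambda>i. fst (xs ! i)) (\<lambda>i. snd (xs ! i)) I"
    have fI: "finite I" using I(1) finite_subset by blast
    have less: "i < N" if "i \<in> I" for i using that I(1) by auto
    have "card K < p" "card L < p" using KL assms by simp_all
    then have "I \<inter> K = {}" "I \<inter> L = {}"
      using card_Int_eq_0_of_dvd[OF fI KL(1) _ I(2) fst[OF less]]
        card_Int_eq_0_of_dvd[OF fI KL(2) _ I(2) snd[OF less]] dvd
      unfolding dvd_sums_def by blast+
    then have "I \<subseteq> {..<n}" using I(1) by (fastforce simp: K_def L_def)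
    then have "card I \<le> n" using card_mono[of "{..<n}" I] by simp
    then show False using I(2) assms(2) by simp
  qed
  then have "\<not> has_zero_sum_subseq (integer_mod_group p \<times>\<times> integer_mod_group p) (p * t) xs"
    by (auto simp: has_zero_sum_subseq_iff[OF assms(1) set] len)
  ultimately show ?thesis using len N_def by blast
qed

text \<open>One counterexample of length exactly \<open>l - 1\<close> rules out every smaller bound,
  because admissibility of \<open>m\<close> concerns all lengths from \<open>m\<close> on.\<close>

lemma modified_EGZ_eqI:
  assumes "\<And>xs. zero_sum G xs \<Longrightarrow> l \<le> length xs \<Longrightarrow> has_zero_sum_subseq G L xs"
    and "\<exists>xs. zero_sum G xs \<and> length xs = l - 1 \<and> \<not> has_zero_sum_subseq G L xs"
  shows "modified_EGZ L G = enat l"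
  unfolding modified_EGZ_def
proof (rule antisym)
  show "Inf {enat l | l. \<forall>xs. zero_sum G xs \<and> length xs \<ge> l \<longrightarrow> has_zero_sum_subseq G L xs} \<le> enat l"
    using assms(1) by (intro Inf_lower) auto
  obtain xs where xs: "zero_sum G xs" "length xs = l - 1" "\<not> has_zero_sum_subseq G L xs"
    using assms(2) by blast
  show "enat l \<le> Inf {enat l | l. \<forall>xs. zero_sum G xs \<and> length xs \<ge> l \<longrightarrow> has_zero_sum_subseq G L xs}"
  proof (rule Inf_greatest, clarify)
    fix m assume m: "\<forall>xs. zero_sum G xs \<and> length xs \<ge> m \<longrightarrow> has_zero_sum_subseq G L xs"
    then have "l - 1 < m" using xs by (metis not_le)
    then show "enat l \<le> enat m" by simp
  qed
qed

lemma has_zero_sum_subseq_mult: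
  assumes p: "prime p" and t: "t \<ge> 2"
    and xs: "zero_sum (integer_mod_group p \<times>\<times> integer_mod_group p) xs" "(t + 2) * p - 2 \<le> length xs"
  shows "has_zero_sum_subseq (integer_mod_group p \<times>\<times> integer_mod_group p) (p * t) xs"
proof -
  have p0: "p > 0" using p prime_gt_0_nat by auto
  then have "set xs \<subseteq> {0..<int p} \<times> {0..<int p}"
    using xs(1) zero_sum_integer_mod_group_prod_iff by blast
  then show ?thesis
    using dvd_sums_tp[OF p t, of "{..<length xs}"] xs(2) by (simp add: has_zero_sum_subseq_iff[OF p0])
qed

theorem theorem1p5:
  fixes p t :: nat
  assumes "prime p" and "t \<ge> 2"
  shows "(p \<noteq> 3 \<longrightarrow>
            modified_EGZ (p * t) (integer_mod_group p \<times>\<times> integer_mod_group p)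
              = enat ((t + 2) * p - 2)) \<and>
         (p = 3 \<longrightarrow>
            modified_EGZ (3 * t) (integer_mod_group 3 \<times>\<times> integer_mod_group 3)
              = enat (3 * (t + 1)))"
proof (intro conjI impI)
  assume "p \<noteq> 3"
  have p2: "p \<ge> 2" using assms(1) prime_ge_2_nat by auto
  have pt: "p * t \<ge> 2 * 2" using p2 assms(2) by (rule mult_le_mono)
  have "coprime 3 p" using assms(1) \<open>p \<noteq> 3\<close> by (intro primes_coprime) auto
  then have "coprime (3 :: int) (int p)"
    using coprime_int_iff[of 3 p] by simp
  \<comment> \<open>The length is -3 modulo \<open>p\<close> and the untranslated coordinate sums
    are -1, so translating by \<open>- x\<close>, with \<open>x\<close> the inverse of 3, makes both
    sums vanish.\<close>
  then obtain x where "[3 * x = 1] (mod int p)" using cong_solve_coprime_int by blast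
  then have x: "int p dvd 3 * x - 1" by (simp add: cong_iff_dvd_diff)
  define n where "n = p * t - 1"
  have n: "n + (p - 1) + (p - 1) = (t + 2) * p - 2 - 1" "n < p * t"
    using p2 pt by (auto simp: n_def algebra_simps)
  have "n + (p - 1) + (p - 1) + 3 = p * (t + 2)"
    using p2 pt by (auto simp: n_def algebra_simps)
  then have "int (n + (p - 1) + (p - 1) + 3) = int (p * (t + 2))" by (simp only:)
  then have N: "int (n + (p - 1) + (p - 1)) = int p * (int t + 2) - 3" by (simp add: algebra_simps)
  have p1: "int (p - 1) = int p - 1" using p2 by simp
  have "int (n + (p - 1) + (p - 1)) * (- x) + int (p - 1) = int p * (1 - x * (int t + 2)) + (3 * x - 1)"
    unfolding N p1 by (simp add: algebra_simps)
  then have "int p dvd int (n + (p - 1) + (p - 1)) * (- x) + int (p - 1)"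
    using x by (metis dvd_add dvd_triv_left)
  with n show "modified_EGZ (p * t) (integer_mod_group p \<times>\<times> integer_mod_group p) = enat ((t + 2) * p - 2)"
    using zero_sum_without_subseq[of p n t "p - 1" "p - 1" "- x" "- x"] p2
      has_zero_sum_subseq_mult[OF assms]
    by (intro modified_EGZ_eqI) auto
next
  let ?G = "integer_mod_group 3 \<times>\<times> integer_mod_group 3"
  show "modified_EGZ (3 * t) ?G = enat (3 * (t + 1))"
  proof (rule modified_EGZ_eqI)
    fix xs assume xs: "zero_sum ?G xs" "3 * (t + 1) \<le> length xs"
    have set: "set xs \<subseteq> {0..<int 3} \<times> {0..<int 3}"
      using xs(1) zero_sum_integer_mod_group_prod_iff[of 3] by auto
    show "has_zero_sum_subseq ?G (3 * t) xs"
    proof (cases "length xs = 3 * (t + 1)")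
      case True
      then show ?thesis
        using dvd_sums_3t[OF assms(2), of "{..<length xs}"] xs(1)
        by (simp add: has_zero_sum_subseq_iff[OF _ set] zero_sum_iff_dvd_sums[OF _ set])
    next
      case False
      then have "(t + 2) * 3 - 2 \<le> length xs" using xs(2) by simp
      then show ?thesis using has_zero_sum_subseq_mult[OF _ assms(2) xs(1)] by simp
    qed
  next
    \<comment> \<open>With two copies of the first unit vector and one of the second the length is
      \<open>3 * t + 2\<close>; translation by \<open>(2, 1)\<close> gives these two coordinate
      sums.\<close>
    have "3 dvd 6 * int t + 6" "3 dvd 3 * int t + 3" by presburger+
    then show "\<exists>xs. zero_sum ?G xs \<and> length xs = 3 * (t + 1) - 1 \<and> \<not> has_zero_sum_subseq ?G (3 * t) xs"
      using zero_sum_without_subseq[of 3 "3 * t - 1" t 2 1 2 1] assms(2)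
      by (simp add: of_nat_diff algebra_simps)
  qed
qed

end
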